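(* For the revenue-maximization variant of the online stopping problem, there exists a (randomized) algorithm that achieves regret at most $1/e$ even when the buyers' values are chosen adversarially (with arbitrary arrival order): namely, draw $\alpha$ uniformly from $[-1,0]$ and post the uniform price $p=e^{\alpha}$ to every buyer. For every $n$ and all values $x_1,\dots,x_n\in[0,1]$, $\max_i x_i-\mathbb{E}[\text{revenue}]\le 1/e$.
   Context: Revenue-maximization variant: a seller sells one item to $n$ buyers arriving sequentially; buyer $i$ has value $x_i\in[0,1]$. Before buyer $i$ arrives, the seller posts a price $p_i$; if $x_i\ge p_i$, buyer $i$ buys the item, the seller obtains revenue $p_i$, and the process ends. The regret is $\max_i x_i$ minus the seller's expected revenue. *)

theory Defs
  imports "HOL-Probability.Probability"
begin

text \<open>
  Revenue from posting the price \<open>p i\<close> to the buyer in position \<open>i\<close> (counted from 0) of the list of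
  values, which is given in arrival order.
\<close>

fun revenue :: "(nat \<Rightarrow> real) \<Rightarrow> real list \<Rightarrow> real" where
  "revenue p [] = 0"
| "revenue p (x # xs) = (if x \<ge> p 0 then p 0 else revenue (\<lambda>i. p (Suc i)) xs)"

text \<open>
  A randomized pricing algorithm is given by a probability space \<open>M\<close> of random seeds and, for each
  seed, a sequence of prices. Prices need not depend on a history: the process is still running
  when a buyer arrives only if every earlier buyer has declined, so the purchase decisions seen so
  far carry no information beyond the position of that buyer.
\<close>

definition randomized_pricing :: "'w measure \<Rightarrow> ('w \<Rightarrow> nat \<Rightarrow> real) \<Rightarrow> bool" where
  "randomized_pricing M P \<longleftrightarrow>
     prob_space M \<and>
     (\<forall>i. (\<lambda>\<omega>. P \<omega> i) \<in> borel_measurable M) \<and>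
     (\<forall>\<omega>\<in>space M. \<forall>i. 0 \<le> P \<omega> i)"

definition expected_revenue :: "'w measure \<Rightarrow> ('w \<Rightarrow> nat \<Rightarrow> real) \<Rightarrow> real list \<Rightarrow> real" where
  "expected_revenue M P xs = (LINT \<omega>|M. revenue (P \<omega>) xs)"

definition regret :: "'w measure \<Rightarrow> ('w \<Rightarrow> nat \<Rightarrow> real) \<Rightarrow> real list \<Rightarrow> real" where
  "regret M P xs = Max (set xs) - expected_revenue M P xs"

text \<open>The integral defining the expected revenue always exists.\<close>

lemma revenue_nonneg: "(\<And>i. 0 \<le> p i) \<Longrightarrow> 0 \<le> revenue p xs"
  by (induction xs arbitrary: p) auto

lemma revenue_le_1: "set xs \<subseteq> {0..1} \<Longrightarrow> revenue p xs \<le> 1"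
  by (induction xs arbitrary: p) auto

lemma revenue_measurable:
  "(\<And>i. (\<lambda>\<omega>. P \<omega> i) \<in> borel_measurable M) \<Longrightarrow> (\<lambda>\<omega>. revenue (P \<omega>) xs) \<in> borel_measurable M"
proof (induction xs arbitrary: P)
  case (Cons x xs)
  note [measurable] = Cons.prems
  have [measurable]: "(\<lambda>\<omega>. revenue (\<lambda>i. P \<omega> (Suc i)) xs) \<in> borel_measurable M"
    by (rule Cons.IH) (rule Cons.prems)
  show ?case by simp
qed simp

lemma revenue_integrable:
  assumes "randomized_pricing M P" "set xs \<subseteq> {0..1}"
  shows "integrable M (\<lambda>\<omega>. revenue (P \<omega>) xs)"
proof -
  interpret prob_space M using assms by (simp add: randomized_pricing_def)
  show ?thesis
  proof (rule integrable_const_bound[where B = 1])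
    show "AE \<omega> in M. norm (revenue (P \<omega>) xs) \<le> 1"
      using assms revenue_nonneg revenue_le_1
      by (intro AE_I2) (auto simp: randomized_pricing_def)
    show "(\<lambda>\<omega>. revenue (P \<omega>) xs) \<in> borel_measurable M"
      using assms by (intro revenue_measurable) (auto simp: randomized_pricing_def)
  qed
qed

end

theory Submission
  imports Defs
begin

text \<open>
  Let \<open>m\<close> be the largest value. A uniform price \<open>e\<^sup>\<alpha>\<close> is accepted by some buyer exactly when
  \<open>\<alpha> \<le> ln m\<close>. If \<open>m \<ge> 1/e\<close>, the expected revenue is therefore the integral of \<open>e\<^sup>\<alpha>\<close> over
  \<open>[-1, ln m]\<close>, which is \<open>m - 1/e\<close>; if \<open>m < 1/e\<close>, nonnegativity of the revenue suffices.
\<close>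

text \<open>A constant price sequence is unchanged by the shift in \<open>revenue\<close>, so after
  a refusal the induction hypothesis applies directly to the tail. From here on the arrival order
  has dropped out.\<close>

lemma revenue_uniform_price:
  assumes "xs \<noteq> []"
  shows "revenue (\<lambda>_. q) xs = (if q \<le> Max (set xs) then q else 0)"
  using assms
proof (induction xs)
  case (Cons x xs)
  then show ?case by (cases "xs = []") (auto simp: le_max_iff_disj)
qed simp

text \<open>The interval has length 1, so the normalizing factor is 1 and the density is the bare
  indicator.\<close>

lemma integral_uniform_measure_interval:
  fixes f :: "real \<Rightarrow> real"
  assumes "f \<in> borel_measurable borel"
  shows "(LINT \<alpha>|uniform_measure lborel {-1..0}. f \<alpha>) = (LINT \<alpha>|lborel. indicator {-1..0} \<alpha> * f \<alpha>)"
proof -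
  have "uniform_measure lborel {-1..0::real} = density lborel (\<lambda>\<alpha>. ennreal (indicator {-1..0} \<alpha>))"
    unfolding uniform_measure_def
    by (intro arg_cong[where f = "density lborel"])
       (auto simp: ennreal_indicator divide_ennreal_def)
  then show ?thesis
    using assms by (simp add: integral_density)
qed

lemma randomized_pricing_exp_uniform:
  "randomized_pricing (uniform_measure lborel {-1..0::real}) (\<lambda>\<alpha> i. exp \<alpha>)"
  unfolding randomized_pricing_def
  by (auto intro!: prob_space_uniform_measure)

lemma expected_revenue_exp_uniform:
  assumes "xs \<noteq> []" and m: "exp (-1) \<le> Max (set xs)" "Max (set xs) \<le> 1"
  shows "expected_revenue (uniform_measure lborel {-1..0::real}) (\<lambda>\<alpha> i. exp \<alpha>) xs
           = Max (set xs) - exp (-1)"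
proof -
  define m where "m = Max (set xs)"
  have m_pos: "m > 0" and ln_m: "-1 \<le> ln m" "ln m \<le> 0"
    using m exp_gt_zero[of "-1::real"] by (auto simp: m_def ln_ge_iff simp del: exp_gt_zero)
  have "expected_revenue (uniform_measure lborel {-1..0::real}) (\<lambda>\<alpha> i. exp \<alpha>) xs
          = (LINT \<alpha>|lborel. indicator {-1..0} \<alpha> * (if exp \<alpha> \<le> m then exp \<alpha> else 0))"
    unfolding expected_revenue_def revenue_uniform_price[OF assms(1)] m_def
    by (rule integral_uniform_measure_interval) measurable
  \<comment> \<open>As \<open>m > 0\<close>, the condition \<open>exp \<alpha> \<le> m\<close> means
    \<open>\<alpha> \<le> ln m\<close>; as \<open>ln m \<le> 0\<close>, this cuts
    \<open>{-1..0}\<close> down to exactly \<open>{-1..ln m}\<close>.\<close>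
  also have "\<dots> = (LINT \<alpha>|lborel. indicator {-1..ln m} \<alpha> *\<^sub>R exp \<alpha>)"
    using m_pos
    by (intro Bochner_Integration.integral_cong)
       (auto simp: indicator_def ln_ge_iff[symmetric] simp del: ln_ge_iff
         intro: order_trans[OF _ ln_m(2)])
  \<comment> \<open>\<open>exp\<close> is its own antiderivative; the endpoints are in order because
    \<open>m\<close> is at least \<open>exp (-1)\<close>.\<close>
  also have "\<dots> = exp (ln m) - exp (-1)"
    using ln_m
    by (intro integral_FTC_atLeastAtMost)
       (auto intro!: continuous_intros DERIV_exp
          simp: has_real_derivative_iff_has_vector_derivative[symmetric]
          intro: has_field_derivative_at_within)
  finally show ?thesis
    using m_pos by (simp add: m_def)
qed

theorem theoremA3:
  "\<exists>(M :: real measure) (P :: real \<Rightarrow> nat \<Rightarrow> real).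
     M = uniform_measure lborel {-1..0} \<and>
     P = (\<lambda>\<alpha> i. exp \<alpha>) \<and>
     randomized_pricing M P \<and>
     (\<forall>xs :: real list. xs \<noteq> [] \<and> set xs \<subseteq> {0..1} \<longrightarrow> regret M P xs \<le> 1 / exp 1)"
proof (intro exI conjI allI impI)
  show "randomized_pricing (uniform_measure lborel {-1..0::real}) (\<lambda>\<alpha> i. exp \<alpha>)"
    by (rule randomized_pricing_exp_uniform)
next
  fix xs :: "real list"
  assume xs: "xs \<noteq> [] \<and> set xs \<subseteq> {0..1}"
  then have "Max (set xs) \<in> set xs"
    by (intro Max_in) auto
  with xs have le_1: "Max (set xs) \<le> 1"
    by auto
  show "regret (uniform_measure lborel {-1..0}) (\<lambda>\<alpha> i. exp \<alpha>) xs \<le> 1 / exp 1"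
  proof (cases "exp (-1) \<le> Max (set xs)")
    case True
    \<comment> \<open>Here the regret equals \<open>1 / exp 1\<close> exactly, whatever the maximum
      is.\<close>
    with xs le_1 show ?thesis
      by (simp add: regret_def expected_revenue_exp_uniform exp_minus inverse_eq_divide)
  next
    case False
    \<comment> \<open>The regret is then at most the maximum, which is below \<open>exp (-1)\<close>
      in this case.\<close>
    have "0 \<le> expected_revenue (uniform_measure lborel {-1..0::real}) (\<lambda>\<alpha> i. exp \<alpha>) xs"
      unfolding expected_revenue_def
      by (intro Bochner_Integration.integral_nonneg revenue_nonneg) simp
    with False show ?thesis
      by (simp add: regret_def exp_minus inverse_eq_divide)
  qed
qed (rule refl)+

end
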